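(* Let $G$ be a connected unicyclic graph of order $n$ whose single cycle has size $c\ge3$. If $\mathbf{X}_G=\sum_{\lambda\vdash n}c_\lambda\,\mathfrak{st}_\lambda$ is the star-expansion of $\mathbf{X}_G$, then \[c_{(n)}=c-1.\]
   Context: All graphs are finite and simple. The chromatic symmetric function of a graph $G$ with vertices $v_1,\dots,v_n$ is $\mathbf{X}_G=\sum_\kappa x_{\kappa(v_1)}\cdots x_{\kappa(v_n)}$, summed over all proper colorings $\kappa:V(G)\to\mathbb{N}$. The star graph $\mathsf{St}_k$ on $k$ vertices is the tree with one central vertex adjacent to $k-1$ leaves ($\mathsf{St}_1$ is a single vertex); $\mathfrak{st}_k:=\mathbf{X}_{\mathsf{St}_k}$, and for a partition $\lambda=(\lambda_1,\dots,\lambda_\ell)$, $\mathfrak{st}_\lambda:=\mathfrak{st}_{\lambda_1}\cdots\mathfrak{st}_{\lambda_\ell}$. The set $\{\mathfrak{st}_\lambda:\lambda\vdash n\}$ is a $\mathbb{Q}$-basis (the star-basis) of the space of homogeneous symmetric functions of degree $n$, so $\mathbf{X}_G=\sum_{\lambda\vdash n}c_\lambda\mathfrak{st}_\lambda$ with uniquely determined coefficients $c_\lambda$. A unicyclic graph is a graph containing exactly one cycle. *)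

theory Defs
  imports
    Complex_Main
    "HOL-Library.Multiset"
    "HOL-Library.FuncSet"
    "Graph_Theory.Digraph_Component"
    "Graph_Theory.Pair_Digraph"
begin

section \<open>Formal power series in infinitely many commuting variables\<close>

text \<open>
  The variables are \<open>x\<^sub>i\<close> for \<open>i :: nat\<close>. A monomial is encoded as the multiset of the indices of
  its variables, so \<open>{#0, 0, 3#}\<close> stands for \<open>x\<^sub>0\<^sup>2 x\<^sub>3\<close>, and a series as the function that sends
  each monomial to its coefficient. Symmetric functions are particular such series, with the
  same ring operations.
\<close>

typedef 'a mps = "UNIV :: (nat multiset \<Rightarrow> 'a) set"
  morphisms mps_coeff Abs_mps ..

setup_lifting type_definition_mps

lemma mps_eqI: "(\<And>M. mps_coeff f M = mps_coeff g M) \<Longrightarrow> f = g"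
  by transfer blast

abbreviation mset_splits :: "nat multiset \<Rightarrow> (nat multiset \<times> nat multiset) set" where
  "mset_splits M \<equiv> {(A, B). A + B = M}"

lemma finite_mset_splits [simp, intro]: "finite (mset_splits M)"
proof -
  have "finite {A. set_mset A \<subseteq> set_mset M \<and> size A = k}" for k
    using finite_multisets_of_size [of "set_mset M" k] by (simp add: multisets_of_size_def)
  then have "finite (\<Union>k\<le>size M. {A. set_mset A \<subseteq> set_mset M \<and> size A = k})" (is "finite ?S")
    by blast
  moreover have "mset_splits M \<subseteq> ?S \<times> ?S"
    by auto
  ultimately show ?thesis
    by (meson finite_SigmaI finite_subset)
qed

lemma sum_mset_splits_assoc:
  fixes h :: "nat multiset \<Rightarrow> nat multiset \<Rightarrow> nat multiset \<Rightarrow> 'b :: comm_monoid_add"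
  shows "(\<Sum>(A, B)\<in>mset_splits M. \<Sum>(C, D)\<in>mset_splits A. h C D B) =
         (\<Sum>(A, B)\<in>mset_splits M. \<Sum>(C, D)\<in>mset_splits B. h A C D)"
proof -
  have "(\<Sum>(A, B)\<in>mset_splits M. \<Sum>(C, D)\<in>mset_splits A. h C D B) =
        (\<Sum>((A, B), C, D)\<in>(SIGMA p:mset_splits M. mset_splits (fst p)). h C D B)"
    by (subst sum.Sigma [symmetric]) (auto intro!: sum.cong)
  also have "\<dots> = (\<Sum>((A, B), C, D)\<in>(SIGMA p:mset_splits M. mset_splits (snd p)). h A C D)"
    by (rule sum.reindex_bij_witness [where
          i = "\<lambda>((A, B), C, D). ((A + C, D), A, C)" and
          j = "\<lambda>((A, B), C, D). ((C, D + B), D, B)"])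
      (auto simp: add.assoc)
  also have "\<dots> = (\<Sum>(A, B)\<in>mset_splits M. \<Sum>(C, D)\<in>mset_splits B. h A C D)"
    by (subst sum.Sigma [symmetric]) (auto intro!: sum.cong)
  finally show ?thesis .
qed

instantiation mps :: (comm_ring_1) comm_ring_1
begin

lift_definition zero_mps :: "'a mps" is "\<lambda>_. 0" .

lift_definition one_mps :: "'a mps" is "\<lambda>M. if M = {#} then 1 else 0" .

lift_definition plus_mps :: "'a mps \<Rightarrow> 'a mps \<Rightarrow> 'a mps" is "\<lambda>f g M. f M + g M" .

lift_definition uminus_mps :: "'a mps \<Rightarrow> 'a mps" is "\<lambda>f M. - f M" .

lift_definition minus_mps :: "'a mps \<Rightarrow> 'a mps \<Rightarrow> 'a mps" is "\<lambda>f g M. f M - g M" .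

lift_definition times_mps :: "'a mps \<Rightarrow> 'a mps \<Rightarrow> 'a mps"
  is "\<lambda>f g M. \<Sum>(A, B)\<in>mset_splits M. f A * g B" .

instance
proof
  fix f g h :: "'a mps"
  show "f * g * h = f * (g * h)"
  proof transfer
    fix f g h :: "nat multiset \<Rightarrow> 'a"
    show "(\<lambda>M. \<Sum>(A, B)\<in>mset_splits M. (\<Sum>(A, B)\<in>mset_splits A. f A * g B) * h B) =
          (\<lambda>M. \<Sum>(A, B)\<in>mset_splits M. f A * (\<Sum>(A, B)\<in>mset_splits B. g A * h B))"
      using sum_mset_splits_assoc [of "\<lambda>A B C. f A * g B * h C"]
      by (simp add: sum_distrib_left sum_distrib_right case_prod_unfold mult.assoc)
  qed
  show "f * g = g * f"
  proof transfer
    fix f g :: "nat multiset \<Rightarrow> 'a"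
    show "(\<lambda>M. \<Sum>(A, B)\<in>mset_splits M. f A * g B) = (\<lambda>M. \<Sum>(A, B)\<in>mset_splits M. g A * f B)"
      by (intro ext sum.reindex_bij_witness [where i = prod.swap and j = prod.swap])
        (auto simp: ac_simps)
  qed
  show "1 * f = f"
  proof transfer
    fix f :: "nat multiset \<Rightarrow> 'a"
    show "(\<lambda>M. \<Sum>(A, B)\<in>mset_splits M. (if A = {#} then 1 else 0) * f B) = f"
    proof
      fix M
      have "(\<Sum>(A, B)\<in>mset_splits M. (if A = {#} then 1 else 0) * f B) =
            (\<Sum>(A, B)\<in>{({#} :: nat multiset, M)}. (if A = {#} then 1 else 0) * f B)"
        by (rule sum.mono_neutral_right) (auto split: if_splits)
      then show "(\<Sum>(A, B)\<in>mset_splits M. (if A = {#} then 1 else 0) * f B) = f M"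
        by simp
    qed
  qed
  show "(f + g) * h = f * h + g * h"
    by transfer (simp add: case_prod_unfold distrib_right sum.distrib)
  show "(0 :: 'a mps) \<noteq> 1"
    by transfer (metis zero_neq_one)
qed (transfer; simp add: ac_simps; fail)+

end

lift_definition mps_scale :: "'a :: comm_ring_1 \<Rightarrow> 'a mps \<Rightarrow> 'a mps" is "\<lambda>c f M. c * f M" .


section \<open>Chromatic symmetric functions\<close>

text \<open>
  A finite simple graph is a term satisfying \<^const>\<open>pair_graph\<close>: each undirected edge \<open>{u, v}\<close> is
  represented by the two arcs \<open>(u, v)\<close> and \<open>(v, u)\<close>.
\<close>

text \<open>
  Colorings are made extensional outside the vertex set, so that each coloring of the vertices is
  counted exactly once.
\<close>

definition proper_colorings :: "'a pair_pre_digraph \<Rightarrow> ('a \<Rightarrow> nat) set" where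
  "proper_colorings G =
     {\<kappa> \<in> pverts G \<rightarrow>\<^sub>E UNIV. \<forall>(u, v)\<in>parcs G. \<kappa> u \<noteq> \<kappa> v}"

text \<open>
  The coefficient of a monomial in the formal sum of \<open>x\<^bsub>\<kappa> v\<^sub>1\<^esub> \<cdots> x\<^bsub>\<kappa> v\<^sub>n\<^esub>\<close> over all proper colorings \<open>\<kappa>\<close>
  is the number of \<open>\<kappa>\<close> that produce this monomial. It is finite because such a \<open>\<kappa>\<close> takes only the
  colors occurring in the monomial.
\<close>

lift_definition chromatic_symfun :: "'a pair_pre_digraph \<Rightarrow> rat mps" is
  "\<lambda>G M. of_nat (card {\<kappa> \<in> proper_colorings G. image_mset \<kappa> (mset_set (pverts G)) = M})" .

lemma finite_proper_colorings_monomial: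
  assumes "finite (pverts G)"
  shows "finite {\<kappa> \<in> proper_colorings G. image_mset \<kappa> (mset_set (pverts G)) = M}"
proof (rule finite_subset)
  show "{\<kappa> \<in> proper_colorings G. image_mset \<kappa> (mset_set (pverts G)) = M}
          \<subseteq> pverts G \<rightarrow>\<^sub>E set_mset M"
    using assms by (auto simp: proper_colorings_def PiE_iff extensional_def)
qed (simp add: assms finite_PiE)


section \<open>Stars and the star-basis\<close>

definition star_graph :: "nat \<Rightarrow> nat pair_pre_digraph" where
  "star_graph k = \<lparr>pverts = {..<k}, parcs = {0} \<times> {1..<k} \<union> {1..<k} \<times> {0}\<rparr>"

lemma pair_graph_star_graph: "pair_graph (star_graph k)"
  by unfold_locales
    (auto simp: star_graph_def symmetric_def arcs_ends_def arc_to_ends_def intro!: symI)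

definition star_symfun :: "nat multiset \<Rightarrow> rat mps" where
  "star_symfun \<mu> = (\<Prod>k\<in>#\<mu>. chromatic_symfun (star_graph k))"

definition partitions :: "nat \<Rightarrow> nat multiset set" where
  "partitions n = {\<mu>. 0 \<notin># \<mu> \<and> sum_mset \<mu> = n}"

lemma finite_partitions: "finite (partitions n)"
proof -
  have "size \<mu> \<le> sum_mset \<mu> \<and> (\<forall>k\<in>#\<mu>. k \<le> sum_mset \<mu>)" if "0 \<notin># \<mu>" for \<mu> :: "nat multiset"
    using that by (induction \<mu>) (auto intro: trans_le_add1 trans_le_add2 simp: Suc_le_eq)
  then have "partitions n \<subseteq> (\<Union>k\<le>n. {\<mu>. set_mset \<mu> \<subseteq> {..n} \<and> size \<mu> = k})"
    by (fastforce simp: partitions_def)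
  moreover have "finite (\<Union>k\<le>n. {\<mu>. set_mset \<mu> \<subseteq> {..n} \<and> size \<mu> = k})"
    using finite_multisets_of_size [of "{..n}"] by (auto simp: multisets_of_size_def)
  ultimately show ?thesis
    by (rule finite_subset)
qed


section \<open>Unicyclic graphs\<close>

text \<open>
  A closed walk \<open>u, v, u\<close> along a single edge is a cycle in the sense of \<^const>\<open>pre_digraph.cycle\<close>;
  requiring length at least 3 leaves the cycles of the undirected graph. A cycle is identified with
  its set of undirected edges, so that its traversals from different starting points and in both
  directions are the same cycle; its size is then the cardinality of this set.
\<close>

definition graph_cycles :: "'a pair_pre_digraph \<Rightarrow> 'a set set set" where
  "graph_cycles G =
     {(\<lambda>(u, v). {u, v}) ` set p |p. pre_digraph.cycle (with_proj G) p \<and> length p \<ge> 3}"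

definition unicyclic :: "'a pair_pre_digraph \<Rightarrow> bool" where
  "unicyclic G \<longleftrightarrow> (\<exists>!C. C \<in> graph_cycles G)"

end

theory Submission
  imports Defs "HOL-Computational_Algebra.Formal_Power_Series"
begin

text \<open>
  Let \<open>z\<close> be a primitive \<open>n\<close>-th root of unity and substitute \<open>x\<^sub>i = z\<^sup>i\<close> for \<open>i < n\<close> and
  \<open>x\<^sub>i = 0\<close> otherwise. This kills the power sums of degree \<open>0 < k < n\<close>, hence the chromatic
  symmetric function of every nonempty graph with fewer than \<open>n\<close> vertices, and in particular every
  \<open>st\<^sub>\<mu>\<close> with \<open>\<mu> \<turnstile> n\<close> other than \<open>\<mu> = (n)\<close>. By inclusion-exclusion over the set
  \<open>S\<close> of edges that are monochromatic, a graph on \<open>n\<close> vertices is sent to \<open>n\<close> times the sum of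
  \<open>(-1)\<^bsup>card S\<^esup>\<close> over the edge sets \<open>S\<close> that connect all vertices. For the star only the full
  edge set contributes, giving \<open>(-1)\<^bsup>n-1\<^esup>\<close>. A connected unicyclic graph has \<open>n\<close> edges, and
  the contributing sets are the full one and those that omit a single edge of the cycle, giving
  \<open>(-1)\<^sup>n + c (-1)\<^bsup>n-1\<^esup>\<close>.
\<close>

section \<open>Substitution of finitely many values\<close>

text \<open>
  The series variable records the degree: summing over all monomials at once would not be a finite
  sum, whereas graded in this way the substitution is a ring homomorphism on all series.
\<close>

definition specialize :: "nat set \<Rightarrow> (nat \<Rightarrow> complex) \<Rightarrow> rat mps \<Rightarrow> complex fps" where
  "specialize A x f =
     Abs_fps (\<lambda>d. \<Sum>M\<in>multisets_of_size A d. of_rat (mps_coeff f M) * (\<Prod>i\<in>#M. x i))"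

lemma specialize_add: "specialize A x (f + g) = specialize A x f + specialize A x g"
  by (rule fps_ext)
    (simp add: specialize_def plus_mps.rep_eq of_rat_add distrib_right sum.distrib)

lemma specialize_0: "specialize A x 0 = 0"
  by (rule fps_ext) (simp add: specialize_def zero_mps.rep_eq)

lemma specialize_sum: "specialize A x (\<Sum>i\<in>I. f i) = (\<Sum>i\<in>I. specialize A x (f i))"
  by (induction I rule: infinite_finite_induct) (simp_all add: specialize_0 specialize_add)

lemma specialize_scale:
  "specialize A x (mps_scale c f) = fps_const (of_rat c) * specialize A x f"
  by (rule fps_ext)
    (simp add: specialize_def mps_scale.rep_eq of_rat_mult sum_distrib_left mult.assoc)

lemma specialize_1: "specialize A x 1 = 1"
proof (rule fps_ext)
  fix d
  show "fps_nth (specialize A x 1) d = fps_nth 1 d"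
  proof (cases "d = 0")
    case True
    have "multisets_of_size A 0 = {{#}}"
      by (auto simp: multisets_of_size_def)
    with True show ?thesis
      by (simp add: specialize_def one_mps.rep_eq)
  next
    case False
    then have "\<forall>M\<in>multisets_of_size A d. M \<noteq> {#}"
      by (auto simp: multisets_of_size_def)
    with False show ?thesis
      by (simp add: specialize_def one_mps.rep_eq)
  qed
qed

text \<open>Splitting a monomial of degree \<open>d\<close> gives factors of degrees
  \<open>k\<close> and \<open>d - k\<close>; grouping by \<open>k\<close> yields the Cauchy product.
  Finiteness of \<open>A\<close> keeps each degree a finite sum.\<close>

lemma specialize_mult:
  assumes "finite A"
  shows "specialize A x (f * g) = specialize A x f * specialize A x g"
proof (rule fps_ext)
  fix d
  let ?P = "multisets_of_size A"
  let ?t = "\<lambda>B C. (of_rat (mps_coeff f B) * (\<Prod>i\<in>#B. x i)) *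
                 (of_rat (mps_coeff g C) * (\<Prod>i\<in>#C. x i))"
  have fin: "finite (?P k)" for k
    using assms by (rule finite_multisets_of_size)
  have "fps_nth (specialize A x (f * g)) d = (\<Sum>M\<in>?P d. \<Sum>(B, C)\<in>mset_splits M. ?t B C)"
    by (auto simp: specialize_def times_mps.rep_eq of_rat_sum of_rat_mult sum_distrib_right
        case_prod_unfold intro!: sum.cong)
  also have "\<dots> = (\<Sum>(M, B, C)\<in>Sigma (?P d) mset_splits. ?t B C)"
    using fin by (subst sum.Sigma) auto
  also have "\<dots> = (\<Sum>(k, B, C)\<in>(SIGMA k:{0..d}. ?P k \<times> ?P (d - k)). ?t B C)"
    by (rule sum.reindex_bij_witness [where
          i = "\<lambda>(k, B, C). (B + C, B, C)" and j = "\<lambda>(M, B, C). (size B, B, C)"])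
      (auto simp: multisets_of_size_def)
  also have "\<dots> = (\<Sum>k=0..d. \<Sum>B\<in>?P k. \<Sum>C\<in>?P (d - k). ?t B C)"
    using fin by (simp add: sum.cartesian_product sum.Sigma)
  also have "\<dots> = fps_nth (specialize A x f * specialize A x g) d"
    by (simp add: specialize_def fps_mult_nth sum_product)
  finally show "fps_nth (specialize A x (f * g)) d = fps_nth (specialize A x f * specialize A x g) d" .
qed

lemma specialize_prod_mset:
  assumes "finite A"
  shows "specialize A x (\<Prod>k\<in>#M. f k) = (\<Prod>k\<in>#M. specialize A x (f k))"
  by (induction M) (simp_all add: specialize_1 specialize_mult assms)

text \<open>Each coloring with colors in \<open>A\<close> contributes one monomial over
  \<open>A\<close>, so summing over monomials with multiplicity is summing over these
  colorings.\<close>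

lemma specialize_chromatic_symfun:
  assumes V: "finite (pverts G)" and A: "finite A"
  shows "specialize A x (chromatic_symfun G) =
    fps_const (\<Sum>\<kappa> | \<kappa> \<in> proper_colorings G \<and> \<kappa> ` pverts G \<subseteq> A. \<Prod>v\<in>pverts G. x (\<kappa> v)) *
    fps_X ^ card (pverts G)"
proof (rule fps_ext)
  fix d
  let ?V = "pverts G"
  let ?m = "\<lambda>\<kappa>. image_mset \<kappa> (mset_set ?V)"
  let ?K = "{\<kappa>. \<kappa> \<in> proper_colorings G \<and> \<kappa> ` ?V \<subseteq> A}"
  have finK: "finite ?K"
  proof (rule finite_subset)
    show "?K \<subseteq> ?V \<rightarrow>\<^sub>E A"
      by (auto simp: proper_colorings_def PiE_iff extensional_def)
  qed (use V A in \<open>simp add: finite_PiE\<close>)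
  have "fps_nth (specialize A x (chromatic_symfun G)) d =
        (\<Sum>M\<in>multisets_of_size A d. \<Sum>\<kappa> | \<kappa> \<in> proper_colorings G \<and> ?m \<kappa> = M. \<Prod>i\<in>#M. x i)"
    by (simp add: specialize_def chromatic_symfun.rep_eq)
  also have "\<dots> = (\<Sum>M\<in>multisets_of_size A d.
      \<Sum>\<kappa> | \<kappa> \<in> proper_colorings G \<and> ?m \<kappa> = M. \<Prod>v\<in>?V. x (\<kappa> v))"
    by (intro sum.cong refl)
      (auto simp: prod_unfold_prod_mset image_mset.compositionality comp_def)
  also have "\<dots> = (\<Sum>(M, \<kappa>)\<in>(SIGMA M:multisets_of_size A d.
      {\<kappa>. \<kappa> \<in> proper_colorings G \<and> ?m \<kappa> = M}). \<Prod>v\<in>?V. x (\<kappa> v))"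
    by (rule sum.Sigma)
      (use A finite_multisets_of_size finite_proper_colorings_monomial [OF V] in auto)
  \<comment> \<open>The monomial \<open>?m \<kappa>\<close> always has degree
    \<open>card ?V\<close>, so every other degree is empty.\<close>
  also have "\<dots> = (\<Sum>\<kappa>\<in>(if d = card ?V then ?K else {}). \<Prod>v\<in>?V. x (\<kappa> v))"
    by (rule sum.reindex_bij_witness [where i = "\<lambda>\<kappa>. (?m \<kappa>, \<kappa>)" and j = snd])
      (use V in \<open>auto simp: multisets_of_size_def split: if_splits\<close>)
  also have "\<dots> = fps_nth (fps_const (\<Sum>\<kappa>\<in>?K. \<Prod>v\<in>?V. x (\<kappa> v)) * fps_X ^ card ?V) d"
    by simp
  finally show "fps_nth (specialize A x (chromatic_symfun G)) d = \<dots>" .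
qed

section \<open>Colorings at a root of unity\<close>

text \<open>For \<open>A\<close> within the vertex set, \<open>A\<close> is a union of components of
  the graph with edges \<open>S\<close>. Cuts replace walks because color shifts and the counting of
  components both act on vertex sets.\<close>

definition uncut :: "'a set set \<Rightarrow> 'a set \<Rightarrow> bool" where
  "uncut S A \<longleftrightarrow> (\<forall>e\<in>S. e \<subseteq> A \<or> e \<inter> A = {})"

definition connects :: "'a set set \<Rightarrow> 'a set \<Rightarrow> bool" where
  "connects S V \<longleftrightarrow> (\<forall>A\<subseteq>V. uncut S A \<longrightarrow> A = {} \<or> A = V)"

definition monochromatic :: "('a \<Rightarrow> nat) \<Rightarrow> 'a set \<Rightarrow> bool" where
  "monochromatic \<kappa> e \<longleftrightarrow> (\<forall>u\<in>e. \<forall>v\<in>e. \<kappa> u = \<kappa> v)"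

text \<open>The two arcs of an undirected edge give the same set, so each edge carries a single sign
  in the inclusion-exclusion.\<close>

definition edges :: "'a pair_pre_digraph \<Rightarrow> 'a set set" where
  "edges G = (\<lambda>(u, v). {u, v}) ` parcs G"

definition monochromatic_colorings :: "'a set \<Rightarrow> nat set \<Rightarrow> 'a set set \<Rightarrow> ('a \<Rightarrow> nat) set" where
  "monochromatic_colorings V A S = {\<kappa> \<in> V \<rightarrow>\<^sub>E A. \<forall>e\<in>S. monochromatic \<kappa> e}"

text \<open>The indicator of properness is the product over all edges of 1 minus the indicator of
  being monochromatic; expanding it gives the signed sum over \<open>S\<close>.\<close>

lemma sum_proper_colorings:
  fixes w :: "('a \<Rightarrow> nat) \<Rightarrow> 'b :: comm_ring_1"
  assumes "finite (pverts G)" "finite (parcs G)" "finite A"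
  shows "(\<Sum>\<kappa> | \<kappa> \<in> proper_colorings G \<and> \<kappa> ` pverts G \<subseteq> A. w \<kappa>) =
    (\<Sum>S\<in>Pow (edges G). (- 1) ^ card S * (\<Sum>\<kappa>\<in>monochromatic_colorings (pverts G) A S. w \<kappa>))"
proof -
  let ?F = "pverts G \<rightarrow>\<^sub>E A" and ?E = "edges G"
  have E: "finite ?E"
    using assms by (simp add: edges_def)
  have F: "finite ?F"
    using assms by (simp add: finite_PiE)
  have proper: "{\<kappa>. \<kappa> \<in> proper_colorings G \<and> \<kappa> ` pverts G \<subseteq> A} =
      {\<kappa> \<in> ?F. \<forall>e\<in>?E. \<not> monochromatic \<kappa> e}"
    by (auto simp: proper_colorings_def monochromatic_def edges_def PiE_iff)
  have of_bool_ball: "(\<Prod>e\<in>S. of_bool (P e)) = (of_bool (\<forall>e\<in>S. P e) :: 'b)"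
    if "finite S" for S :: "'a set set" and P
    using that by (induction S) auto
  have ie: "of_bool (\<forall>e\<in>?E. \<not> monochromatic \<kappa> e) =
      (\<Sum>S\<in>Pow ?E. (- 1) ^ card S * of_bool (\<forall>e\<in>S. monochromatic \<kappa> e) :: 'b)" for \<kappa>
  proof -
    have "of_bool (\<forall>e\<in>?E. \<not> monochromatic \<kappa> e) =
        (\<Prod>e\<in>?E. - of_bool (monochromatic \<kappa> e) + 1 :: 'b)"
      by (subst of_bool_ball [OF E, symmetric]) (auto intro!: prod.cong)
    also have "\<dots> = (\<Sum>S\<in>Pow ?E. \<Prod>e\<in>S. - of_bool (monochromatic \<kappa> e))"
      using E by (subst prod_add) auto
    also have "\<dots> = (\<Sum>S\<in>Pow ?E. (- 1) ^ card S * of_bool (\<forall>e\<in>S. monochromatic \<kappa> e))"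
      using E by (intro sum.cong refl)
        (simp add: prod_uminus of_bool_ball finite_subset del: of_bool_eq_iff)
    finally show ?thesis .
  qed
  have "(\<Sum>\<kappa> | \<kappa> \<in> proper_colorings G \<and> \<kappa> ` pverts G \<subseteq> A. w \<kappa>) =
      (\<Sum>\<kappa>\<in>?F. of_bool (\<forall>e\<in>?E. \<not> monochromatic \<kappa> e) * w \<kappa>)"
    unfolding proper using F by (intro sum.mono_neutral_cong_left) auto
  also have "\<dots> = (\<Sum>S\<in>Pow ?E. (- 1) ^ card S *
      (\<Sum>\<kappa>\<in>?F. of_bool (\<forall>e\<in>S. monochromatic \<kappa> e) * w \<kappa>))"
    unfolding ie sum_distrib_left sum_distrib_right mult.assoc by (rule sum.swap)
  also have "\<dots> = (\<Sum>S\<in>Pow ?E. (- 1) ^ card S *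
      (\<Sum>\<kappa>\<in>monochromatic_colorings (pverts G) A S. w \<kappa>))"
    unfolding monochromatic_colorings_def using F
    by (intro sum.cong refl arg_cong2 [where f = "(*)"] sum.mono_neutral_cong_right) auto
  finally show ?thesis .
qed

section \<open>Cancellation under cyclic shifts of the colors\<close>

lemma power_mod_root_unity:
  fixes z :: "'a :: monoid_mult"
  assumes "z ^ n = 1"
  shows "z ^ (k mod n) = z ^ k"
proof -
  have "z ^ k = z ^ (n * (k div n) + k mod n)"
    by simp
  also have "\<dots> = z ^ (k mod n)"
    using assms by (simp only: power_add power_mult power_one mult_1_left)
  finally show ?thesis ..
qed

text \<open>Shifting the colors on \<open>A\<close> cyclically multiplies every summand by \<open>z ^ card A\<close>.\<close>

lemma sum_monochromatic_eq_0:
  fixes z :: "'b :: idom"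
  assumes "finite V" "A \<subseteq> V" "uncut S A" "z ^ n = 1" "z ^ card A \<noteq> 1" "n > 0"
  shows "(\<Sum>\<kappa>\<in>monochromatic_colorings V {..<n} S. \<Prod>v\<in>V. z ^ \<kappa> v) = 0"
proof -
  let ?K = "monochromatic_colorings V {..<n} S"
  let ?w = "\<lambda>\<kappa>. \<Prod>v\<in>V. z ^ \<kappa> v"
  define shift :: "nat \<Rightarrow> ('a \<Rightarrow> nat) \<Rightarrow> 'a \<Rightarrow> nat" where
    "shift k \<kappa> = (\<lambda>v. if v \<in> A then (\<kappa> v + k) mod n else \<kappa> v)" for k \<kappa>
  have shift_closed: "shift k \<kappa> \<in> ?K" if "\<kappa> \<in> ?K" for k \<kappa>
  proof -
    have "monochromatic (shift k \<kappa>) e" if "e \<in> S" for e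
    proof -
      have "monochromatic \<kappa> e"
        using \<open>\<kappa> \<in> ?K\<close> that by (simp add: monochromatic_colorings_def)
      moreover have "e \<subseteq> A \<or> e \<inter> A = {}"
        using assms that by (simp add: uncut_def)
      ultimately show ?thesis
        unfolding monochromatic_def shift_def
        by (metis disjoint_iff subset_iff)
    qed
    with that assms show ?thesis
      by (auto simp: monochromatic_colorings_def shift_def PiE_iff extensional_def)
  qed
  \<comment> \<open>Used with shifts by \<open>1\<close> and \<open>n - 1\<close>: the shift by one
    permutes the colorings.\<close>
  have shift_shift: "shift l (shift k \<kappa>) = \<kappa>" if "\<kappa> \<in> ?K" "k + l = n" for k l \<kappa>
  proof
    fix v
    have "\<kappa> v < n" if "v \<in> A"
      using \<open>\<kappa> \<in> ?K\<close> that assms by (auto simp: monochromatic_colorings_def)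
    moreover have "((\<kappa> v + k) mod n + l) mod n = (\<kappa> v + (k + l)) mod n"
      by (simp add: mod_simps add.assoc)
    ultimately show "shift l (shift k \<kappa>) v = \<kappa> v"
      using \<open>k + l = n\<close> by (auto simp: shift_def)
  qed
  have "?w (shift 1 \<kappa>) = z ^ card A * ?w \<kappa>" for \<kappa>
  proof -
    have "?w (shift 1 \<kappa>) = (\<Prod>v\<in>V. (if v \<in> A then z else 1) * z ^ \<kappa> v)"
      by (intro prod.cong refl) (simp add: shift_def power_mod_root_unity assms)
    also have "\<dots> = (\<Prod>v\<in>V. if v \<in> A then z else 1) * ?w \<kappa>"
      by (rule prod.distrib)
    also have "(\<Prod>v\<in>V. if v \<in> A then z else 1) = z ^ card A"
      using assms by (simp add: prod.If_cases Int_absorb1)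
    finally show ?thesis .
  qed
  then have "z ^ card A * (\<Sum>\<kappa>\<in>?K. ?w \<kappa>) = (\<Sum>\<kappa>\<in>?K. ?w (shift 1 \<kappa>))"
    by (simp only: sum_distrib_left)
  also have "\<dots> = (\<Sum>\<kappa>\<in>?K. ?w \<kappa>)"
    by (rule sum.reindex_bij_witness [where i = "shift (n - 1)" and j = "shift 1"])
      (use assms in \<open>simp_all add: shift_closed shift_shift del: One_nat_def\<close>)
  finally show ?thesis
    using assms by (metis mult_cancel_right1)
qed

text \<open>The color class of any vertex is uncut by \<open>S\<close>, hence all of
  \<open>V\<close>, so only constant colorings remain.\<close>

lemma monochromatic_colorings_connects:
  assumes "connects S V" "\<Union>S \<subseteq> V" "V \<noteq> {}"
  shows "monochromatic_colorings V A S = (\<lambda>c. \<lambda>v\<in>V. c) ` A"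
proof (intro equalityI subsetI)
  fix \<kappa> assume \<kappa>: "\<kappa> \<in> monochromatic_colorings V A S"
  obtain v0 where v0: "v0 \<in> V"
    using assms by blast
  have uncut: "uncut S {v \<in> V. \<kappa> v = \<kappa> v0}"
    unfolding uncut_def
  proof
    fix e assume "e \<in> S"
    then have "e \<subseteq> V" and const: "\<And>u v. u \<in> e \<Longrightarrow> v \<in> e \<Longrightarrow> \<kappa> u = \<kappa> v"
      using \<kappa> assms unfolding monochromatic_colorings_def monochromatic_def by blast+
    then show "e \<subseteq> {v \<in> V. \<kappa> v = \<kappa> v0} \<or> e \<inter> {v \<in> V. \<kappa> v = \<kappa> v0} = {}"
      using const [THEN trans] by blast
  qed
  have "{v \<in> V. \<kappa> v = \<kappa> v0} = V"
    using assms(1) [unfolded connects_def, rule_format, OF _ uncut] v0 by auto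
  with \<kappa> have "\<kappa> = (\<lambda>v\<in>V. \<kappa> v0)"
    by (auto simp: monochromatic_colorings_def PiE_iff extensional_def restrict_def fun_eq_iff)
  moreover have "\<kappa> v0 \<in> A"
    using \<kappa> v0 by (auto simp: monochromatic_colorings_def)
  ultimately show "\<kappa> \<in> (\<lambda>c. \<lambda>v\<in>V. c) ` A"
    by blast
qed (use assms in \<open>auto simp: monochromatic_colorings_def monochromatic_def, blast+\<close>)

text \<open>If \<open>S\<close> connects \<open>n\<close> vertices, each of the \<open>n\<close>
  constant colorings contributes \<open>(z ^ c) ^ n = 1\<close>. Otherwise some nonempty uncut set
  has fewer than \<open>n\<close> vertices and the shift argument applies.\<close>

lemma sum_monochromatic_root_unity:
  fixes z :: "'b :: idom"
  assumes z: "z ^ n = 1" "\<And>k. 0 < k \<Longrightarrow> k < n \<Longrightarrow> z ^ k \<noteq> 1"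
    and V: "finite V" "V \<noteq> {}" "card V \<le> n"
    and S: "\<Union>S \<subseteq> V"
  shows "(\<Sum>\<kappa>\<in>monochromatic_colorings V {..<n} S. \<Prod>v\<in>V. z ^ \<kappa> v) =
    (if card V = n \<and> connects S V then of_nat n else 0)"
proof (cases "card V = n \<and> connects S V")
  case True
  have "(\<Sum>\<kappa>\<in>monochromatic_colorings V {..<n} S. \<Prod>v\<in>V. z ^ \<kappa> v) = (\<Sum>c<n. 1)"
  proof -
    have "inj_on (\<lambda>c. \<lambda>v\<in>V. c) {..<n}"
      using V by (auto intro!: inj_onI dest: fun_cong split: if_splits simp: restrict_def)
    moreover have "(z ^ c) ^ n = 1" for c
      using z by (metis mult.commute power_mult power_one)
    ultimately show ?thesis
      using True V S by (simp add: monochromatic_colorings_connects sum.reindex)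
  qed
  with True show ?thesis
    by simp
next
  case False
  \<comment> \<open>With fewer than \<open>n\<close> vertices the whole of \<open>V\<close> serves;
    with exactly \<open>n\<close>, a failure of connectedness supplies a proper subset.\<close>
  obtain A where A: "A \<subseteq> V" "uncut S A" "A \<noteq> {}" "card A < n"
  proof (cases "card V = n")
    case True
    with False obtain A where "A \<subseteq> V" "uncut S A" "A \<noteq> {}" "A \<noteq> V"
      by (auto simp: connects_def)
    with True V show ?thesis
      by (intro that [of A]) (auto intro: psubset_card_mono)
  next
    case False
    with V S show ?thesis
      by (intro that [of V]) (auto simp: uncut_def)
  qed
  with V have "0 < card A"
    by (meson card_gt_0_iff finite_subset)
  with A V z False show ?thesis
    by (subst sum_monochromatic_eq_0 [of V A]) auto
qed

lemma specialize_chromatic_root_unity: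
  assumes "pair_graph G"
    and z: "z ^ n = 1" "\<And>k. 0 < k \<Longrightarrow> k < n \<Longrightarrow> z ^ k \<noteq> 1"
    and V: "pverts G \<noteq> {}" "card (pverts G) \<le> n"
  shows "specialize {..<n} (\<lambda>i. z ^ i) (chromatic_symfun G) =
    (if card (pverts G) = n
     then fps_const (of_nat n * (\<Sum>S | S \<subseteq> edges G \<and> connects S (pverts G). (- 1) ^ card S)) *
       fps_X ^ n
     else 0)"
proof -
  interpret pair_graph G by fact
  let ?V = "pverts G" and ?E = "edges G"
  have E: "finite ?E" "\<Union>?E \<subseteq> ?V"
    using pair_finite_arcs wellformed' by (auto simp: edges_def)
  have "(\<Sum>\<kappa> | \<kappa> \<in> proper_colorings G \<and> \<kappa> ` ?V \<subseteq> {..<n}. \<Prod>v\<in>?V. z ^ \<kappa> v) =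
      (\<Sum>S\<in>Pow ?E. (- 1) ^ card S * (if card ?V = n \<and> connects S ?V then of_nat n else 0))"
    unfolding sum_proper_colorings [OF pair_finite_verts pair_finite_arcs finite_lessThan]
    using E V pair_finite_verts
    by (intro sum.cong refl arg_cong2 [where f = "(*)"] sum_monochromatic_root_unity z) auto
  also have "\<dots> = (\<Sum>S | S \<subseteq> ?E \<and> connects S ?V.
      if card ?V = n then of_nat n * (- 1) ^ card S else 0)"
    using E by (intro sum.mono_neutral_cong_right) auto
  finally show ?thesis
    by (simp add: specialize_chromatic_symfun pair_finite_verts sum_distrib_left)
qed

section \<open>Cuts and bridges\<close>

text \<open>The witness \<open>A\<close> is one side of a cut that \<open>e\<close> crosses and no
  other edge of \<open>S\<close> does. Whether \<open>e\<close> lies in \<open>S\<close> is left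
  open, so the property passes to every subset of \<open>S\<close>.\<close>

definition bridge :: "'a set set \<Rightarrow> 'a set \<Rightarrow> 'a set \<Rightarrow> bool" where
  "bridge S V e \<longleftrightarrow>
     (\<exists>A u v. A \<subseteq> V \<and> uncut (S - {e}) A \<and> e = {u, v} \<and> u \<in> A \<and> v \<in> V - A)"

lemma uncut_mono: "uncut S A \<Longrightarrow> T \<subseteq> S \<Longrightarrow> uncut T A"
  unfolding uncut_def by blast

lemma bridge_mono:
  assumes "bridge S V e" "T \<subseteq> S"
  shows "bridge T V e"
proof -
  obtain A u v where A: "A \<subseteq> V" "uncut (S - {e}) A" "e = {u, v}" "u \<in> A" "v \<in> V - A"
    using assms(1) unfolding bridge_def by blast
  moreover have "uncut (T - {e}) A"
    using A(2) by (rule uncut_mono) (use assms(2) in blast)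
  ultimately show ?thesis
    unfolding bridge_def by blast
qed

text \<open>If \<open>S\<close> omitted \<open>e\<close>, the side of the cut witnessing the bridge
  would be a nontrivial set uncut by \<open>S\<close>.\<close>

lemma connects_bridge_mem:
  assumes "connects S V" "bridge T V e" "S \<subseteq> T"
  shows "e \<in> S"
proof (rule ccontr)
  assume "e \<notin> S"
  obtain A u v where A: "A \<subseteq> V" "uncut (T - {e}) A" "u \<in> A" "v \<in> V - A"
    using assms unfolding bridge_def by blast
  moreover have "uncut S A"
    using A(2) \<open>e \<notin> S\<close> assms(3) by (auto simp: uncut_def)
  ultimately show False
    using assms(1) unfolding connects_def by blast
qed

text \<open>Symmetric difference with the side of a cut at \<open>e\<close> exchanges the sets that cut \<open>e\<close>
  with those that do not.\<close>

lemma card_uncut_insert_bridge: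
  assumes "finite V" "bridge (insert e S) V e" "e \<notin> S"
  shows "card {B. B \<subseteq> V \<and> uncut S B} = 2 * card {B. B \<subseteq> V \<and> uncut (insert e S) B}"
proof -
  let ?U = "{B. B \<subseteq> V \<and> uncut S B}" and ?U' = "{B. B \<subseteq> V \<and> uncut (insert e S) B}"
  obtain A u v where A: "A \<subseteq> V" "uncut S A" "e = {u, v}" "u \<in> A" "v \<notin> A"
    using assms unfolding bridge_def by auto
  define flip where "flip B = (B - A) \<union> (A - B)" for B
  have flip_flip: "flip (flip B) = B" for B
    by (auto simp: flip_def)
  have flip_U: "flip B \<in> ?U" if "B \<in> ?U" for B
  proof -
    have "e' \<subseteq> flip B \<or> e' \<inter> flip B = {}" if "e' \<in> S" for e'
    proof -
      have "e' \<subseteq> A \<or> e' \<inter> A = {}" "e' \<subseteq> B \<or> e' \<inter> B = {}"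
        using A(2) \<open>B \<in> ?U\<close> that by (auto simp: uncut_def)
      then show ?thesis
        unfolding flip_def by blast
    qed
    with that A(1) show ?thesis
      by (auto simp: uncut_def flip_def)
  qed
  have U': "?U' = {B \<in> ?U. u \<in> B \<longleftrightarrow> v \<in> B}"
    using A(3) by (auto simp: uncut_def)
  \<comment> \<open>Since \<open>u \<in> A\<close> and \<open>v \<notin> A\<close>,
    \<open>flip\<close> toggles membership of \<open>u\<close> and keeps that of
    \<open>v\<close>.\<close>
  have "flip B \<in> ?U' \<longleftrightarrow> B \<notin> ?U'" if "B \<in> ?U" for B
  proof -
    have "u \<in> flip B \<longleftrightarrow> u \<notin> B" "v \<in> flip B \<longleftrightarrow> v \<in> B"
      using A(4,5) by (auto simp: flip_def)
    with that flip_U [OF that] show ?thesis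
      unfolding U' by blast
  qed
  then have "flip ` ?U' \<subseteq> ?U - ?U'" "flip ` (?U - ?U') \<subseteq> ?U'"
    using flip_U U' by blast+
  then have "bij_betw flip ?U' (?U - ?U')"
    by (intro bij_betw_byWitness [where f' = flip]) (simp_all add: flip_flip)
  then have "card (?U - ?U') = card ?U'"
    by (rule bij_betw_same_card [symmetric])
  moreover have fin: "finite ?U"
    using assms(1) by simp
  moreover have sub: "?U' \<subseteq> ?U"
    unfolding U' by blast
  then have "card (?U - ?U') = card ?U - card ?U'" "card ?U' \<le> card ?U"
    using fin by (blast intro: card_Diff_subset card_mono finite_subset)+
  ultimately show ?thesis
    by linarith
qed

text \<open>All subsets of \<open>V\<close> are uncut by the empty edge set, and each added bridge
  halves their number.\<close>

lemma card_uncut_forest: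
  assumes "finite V" "finite S" "\<And>e. e \<in> S \<Longrightarrow> bridge S V e"
  shows "card {B. B \<subseteq> V \<and> uncut S B} * 2 ^ card S = 2 ^ card V"
  using assms(2,3)
proof (induction S)
  case empty
  then show ?case
    using card_Pow [OF assms(1)] by (simp add: uncut_def Pow_def)
next
  case (insert e S)
  have "bridge S V f" if "f \<in> S" for f
    using insert.prems [of f] that by (auto intro: bridge_mono)
  then show ?case
    using insert card_uncut_insert_bridge [OF assms(1), of e S] by simp
qed

text \<open>Connectedness leaves only \<open>{}\<close> and \<open>V\<close> uncut, so the forest
  count reads \<open>2 * 2 ^ card S = 2 ^ card V\<close>.\<close>

lemma card_tree:
  assumes "finite V" "V \<noteq> {}" "finite S" "\<Union>S \<subseteq> V" "connects S V" "\<And>e. e \<in> S \<Longrightarrow> bridge S V e"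
  shows "card V = Suc (card S)"
proof -
  have "{B. B \<subseteq> V \<and> uncut S B} = {{}, V}"
    using assms unfolding connects_def uncut_def by blast
  then have "card {B. B \<subseteq> V \<and> uncut S B} = 2"
    using assms by simp
  then have "(2 :: nat) ^ Suc (card S) = 2 ^ card V"
    using card_uncut_forest [OF assms(1,3,6)] by simp
  then show ?thesis
    using power_inject_exp [of "2 :: nat"] by (metis one_less_numeral_iff semiring_norm(76))
qed

section \<open>Cycles, cuts and reachability\<close>

lemma pcas_append: "pcas u (p @ q) w \<longleftrightarrow> (\<exists>v. pcas u p v \<and> pcas v q w)"
  by (induction p arbitrary: u) auto

lemma pcas_uncut:
  assumes "pcas u p v" "\<And>a. a \<in> set p \<Longrightarrow> {fst a, snd a} \<in> S" "uncut S A"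
  shows "u \<in> A \<longleftrightarrow> v \<in> A"
  using assms
proof (induction p arbitrary: u)
  case (Cons a p)
  then have "{fst a, snd a} \<subseteq> A \<or> {fst a, snd a} \<inter> A = {}"
    unfolding uncut_def by (meson list.set_intros(1))
  with Cons show ?case
    by auto
qed simp

text \<open>The vertices of the closed walk after the first are the heads of its arcs, which makes
  distinctness independent of the starting point.\<close>

lemma cycle_pcas:
  assumes "pre_digraph.cycle (with_proj G) p"
  obtains u where "pcas u p u" "distinct (map snd p)" "set p \<subseteq> parcs G" "p \<noteq> []"
proof -
  obtain u where u: "pre_digraph.awalk (with_proj G) u p u" "p \<noteq> []"
      "distinct (tl (pre_digraph.awalk_verts (with_proj G) u p))"
    using assms unfolding pre_digraph.cycle_def by blast
  then have "pre_digraph.cas (with_proj G) u p u" "set p \<subseteq> parcs G"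
    by (auto simp: pre_digraph.awalk_def)
  with u show ?thesis
    by (intro that [of u]) (auto simp: pre_digraph.awalk_verts_conv' cas_with_proj_eq)
qed

lemma graph_cycles_subset_edges: "D \<in> graph_cycles G \<Longrightarrow> D \<subseteq> edges G"
  unfolding graph_cycles_def edges_def by (blast elim: cycle_pcas)

text \<open>Rotated to start with an arc of \<open>e\<close>, the cycle returns from one end of \<open>e\<close> to the
  other without using \<open>e\<close>.\<close>

lemma graph_cycle_uncut:
  assumes "D \<in> graph_cycles G" "e \<in> D" "uncut (D - {e}) A"
  shows "e \<subseteq> A \<or> e \<inter> A = {}"
proof -
  obtain p where p: "pre_digraph.cycle (with_proj G) p" "length p \<ge> 3"
      "D = (\<lambda>(u, v). {u, v}) ` set p"
    using assms by (auto simp: graph_cycles_def)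
  obtain w where w: "pcas w p w" "distinct (map snd p)"
    using p(1) by (rule cycle_pcas)
  obtain x y where xy: "(x, y) \<in> set p" "e = {x, y}"
    using assms(2) p(3) by auto
  obtain p1 p2 where p12: "p = p1 @ (x, y) # p2"
    using xy by (meson split_list)
  let ?q = "p2 @ p1"
  have q: "pcas y ?q x"
    using w p12 by (auto simp: pcas_append)
  have dist: "y \<notin> snd ` set ?q" "distinct (map snd ?q)"
    using w p12 by auto
  \<comment> \<open>An arc \<open>(y, x)\<close> would split \<open>?q\<close> into closed walks at
    \<open>y\<close> and at \<open>x\<close>. A nonempty one would repeat the head \<open>y\<close>
    or \<open>x\<close>, so both are empty and the cycle has length 2.\<close>
  have "(y, x) \<notin> set ?q"
  proof
    assume "(y, x) \<in> set ?q"
    then obtain q1 q2 where q12: "?q = q1 @ (y, x) # q2"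
      by (meson split_list)
    have q1: "pcas y q1 y" and q2: "pcas x q2 x"
      using q unfolding q12 by (auto simp: pcas_append)
    have "q2 = []"
    proof (rule ccontr)
      assume "q2 \<noteq> []"
      then obtain q3 a where "q2 = q3 @ [a]"
        by (meson rev_exhaust)
      then have "snd a = x"
        using q2 by (auto simp: pcas_append)
      with \<open>q2 = q3 @ [a]\<close> dist(2) show False
        unfolding q12 by auto
    qed
    have "q1 = []"
    proof (rule ccontr)
      assume "q1 \<noteq> []"
      then obtain q3 a where "q1 = q3 @ [a]"
        by (meson rev_exhaust)
      then have "snd a = y"
        using q1 by (auto simp: pcas_append)
      with \<open>q1 = q3 @ [a]\<close> dist(1) show False
        unfolding q12 by auto
    qed
    with \<open>q2 = []\<close> q12 have "length ?q = 1"
      by simp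
    with p12 p(2) show False
      by simp
  qed
  then have "{fst a, snd a} \<in> D - {e}" if "a \<in> set ?q" for a
    using that dist(1) p12 p(3) xy(2) by (force simp: doubleton_eq_iff)
  then have "y \<in> A \<longleftrightarrow> x \<in> A"
    using pcas_uncut [OF q _ assms(3)] by blast
  with xy show ?thesis
    by auto
qed

text \<open>The cut is the set of vertices reachable from one end \<open>u\<close> of
  \<open>e\<close> along \<open>S - {e}\<close>. If it contained the other end, a path between them
  would close up with \<open>e\<close> to a cycle inside \<open>S\<close>.\<close>

lemma bridgeI_acyclic:
  assumes "pair_graph G" "S \<subseteq> edges G" "e \<in> S"
    and no_cycle: "\<And>D. D \<in> graph_cycles G \<Longrightarrow> e \<in> D \<Longrightarrow> D \<subseteq> S \<Longrightarrow> False"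
  shows "bridge S (pverts G) e"
proof -
  interpret G: pair_graph G by fact
  obtain u v where uv: "e = {u, v}" "(u, v) \<in> parcs G"
    using assms(2,3) by (auto simp: edges_def)
  then have vu: "(v, u) \<in> parcs G"
    using G.arcs_symmetric by blast
  define H where "H = \<lparr>pverts = pverts G, parcs = {(a, b) \<in> parcs G. {a, b} \<in> S - {e}}\<rparr>"
  interpret H: pair_wf_digraph H
    by unfold_locales (auto simp: H_def dest: G.wellformed')
  define A where "A = {w. u \<rightarrow>\<^sup>*\<^bsub>with_proj H\<^esub> w}"
  have H: "pverts H = pverts G" "parcs H = {(a, b) \<in> parcs G. {a, b} \<in> S - {e}}"
    by (simp_all add: H_def)
  have "H.awalk u [] u"
    unfolding H.awalk_Nil_iff H(1) using G.wellformed' uv(2) by blast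
  then have u: "u \<in> A"
    unfolding A_def H.reachable_awalk by blast
  have "A \<subseteq> pverts G"
    unfolding A_def H(1) [symmetric] using H.reachable_in_verts(2) by blast
  moreover have "uncut (S - {e}) A"
  proof -
    have step: "b \<in> A" if "a \<in> A" "{a, b} \<in> S - {e}" "(a, b) \<in> parcs G" for a b
    proof -
      have "(a, b) \<in> parcs H"
        using that(2,3) by (simp add: H(2))
      with that(1) show ?thesis
        unfolding A_def mem_Collect_eq by (rule H.reachable_adj_trans)
    qed
    show ?thesis
      unfolding uncut_def
    proof
      fix f assume f: "f \<in> S - {e}"
      then have "f \<in> edges G"
        using assms(2) by blast
      then obtain a b where ab: "f = {a, b}" "(a, b) \<in> parcs G"
        by (auto simp: edges_def)
      then have "(b, a) \<in> parcs G"
        using G.arcs_symmetric by blast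
      with f ab have "a \<in> A \<longleftrightarrow> b \<in> A"
        using step [of a b] step [of b a] by (auto simp only: insert_commute)
      with ab show "f \<subseteq> A \<or> f \<inter> A = {}"
        by blast
    qed
  qed
  moreover have "v \<notin> A"
  proof
    assume "v \<in> A"
    then obtain p where p: "H.apath u p v"
      by (auto simp: A_def H.reachable_apath)
    let ?p = "(v, u) # p"
    have walk: "pcas u p v" "set p \<subseteq> parcs H" "distinct (pawalk_verts u p)"
      using p by (auto simp: H.apath_def H.awalk_def)
    have arcs: "set p \<subseteq> parcs G" "(\<lambda>(a, b). {a, b}) ` set p \<subseteq> S - {e}"
      using walk(2) by (auto simp: H(2))
    have "G.cycle ?p"
      unfolding G.cycle_def G.awalk_def using walk arcs vu G.wellformed' by auto
    \<comment> \<open>An empty path would make \<open>e\<close> a loop, and a path of one arc would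
      have to use \<open>e\<close> itself.\<close>
    moreover have "length ?p \<ge> 3"
    proof (rule ccontr)
      assume "\<not> length ?p \<ge> 3"
      then consider "p = []" | a where "p = [a]"
        by (cases p; cases "tl p") auto
      then show False
        using walk(1) arcs(2) uv G.no_loops' by cases auto
    qed
    ultimately have "(\<lambda>(a, b). {a, b}) ` set ?p \<in> graph_cycles G"
      unfolding graph_cycles_def by blast
    moreover have "e \<in> (\<lambda>(a, b). {a, b}) ` set ?p" "(\<lambda>(a, b). {a, b}) ` set ?p \<subseteq> S"
      using arcs(2) assms(3) uv(1) by (auto simp: insert_commute)
    ultimately show False
      by (rule no_cycle)
  qed
  moreover have "v \<in> pverts G"
    using uv(2) G.wellformed' by blast
  ultimately show ?thesis
    using u uv(1) unfolding bridge_def by blast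
qed

text \<open>An uncut set is closed under steps along edges in either direction, so a nonempty one
  contains every vertex.\<close>

lemma connected_connects:
  assumes "Digraph_Component.connected (with_proj G)"
  shows "connects (edges G) (pverts G)"
  unfolding connects_def
proof (intro allI impI)
  fix A assume A: "A \<subseteq> pverts G" "uncut (edges G) A"
  have step: "b \<in> A" if "a \<in> A" "(a, b) \<in> (parcs G)\<^sup>s" for a b
    using that A(2) by (auto simp: uncut_def edges_def symcl_def)
  have "b \<in> A" if "a \<in> A" "b \<in> pverts G" for a b
  proof -
    have "(a, b) \<in> rtrancl_on (pverts G) ((parcs G)\<^sup>s)"
      using assms that A(1) by (auto simp: connected_conv)
    then show ?thesis
      by (induction rule: rtrancl_on_induct) (use \<open>a \<in> A\<close> step in auto)
  qed
  with A(1) show "A = {} \<or> A = pverts G"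
    by blast
qed

section \<open>Connecting edge sets of unicyclic graphs and stars\<close>

text \<open>A connecting set contains all edges off \<open>C\<close> and misses at most one edge of
  \<open>C\<close>. The full edge set and the \<open>card C\<close> sets with one edge of
  \<open>C\<close> removed have opposite signs.\<close>

lemma unicyclic_connected_sum:
  assumes "pair_graph G" "Digraph_Component.connected (with_proj G)" "unicyclic G"
    and C: "C \<in> graph_cycles G" "C \<noteq> {}"
  shows "(\<Sum>S | S \<subseteq> edges G \<and> connects S (pverts G). (- 1) ^ card S) =
    (- 1) ^ (card (pverts G) - 1) * (of_nat (card C) - 1 :: 'b :: comm_ring_1)"
proof -
  interpret pair_graph G by fact
  let ?V = "pverts G" and ?E = "edges G"
  have E: "finite ?E" "\<Union>?E \<subseteq> ?V"
    using pair_finite_arcs wellformed' by (auto simp: edges_def)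
  have CE: "C \<subseteq> ?E"
    using C(1) by (rule graph_cycles_subset_edges)
  have unique: "D = C" if "D \<in> graph_cycles G" for D
    using assms(3) C(1) that unfolding unicyclic_def by blast
  have E_conn: "connects ?E ?V"
    using assms(2) by (rule connected_connects)
  have bridge1: "bridge ?E ?V e" if "e \<in> ?E - C" for e
    using assms(1) by (rule bridgeI_acyclic) (use that unique in auto)
  \<comment> \<open>Removing an edge of \<open>C\<close> destroys the only cycle, so all remaining
    edges are bridges.\<close>
  have bridge2: "bridge (?E - {e}) ?V f" if "e \<in> C" "f \<in> ?E - {e}" for e f
    using assms(1) by (rule bridgeI_acyclic) (use that unique in auto)
  have conn: "connects (?E - {e}) ?V" if "e \<in> C" for e
    unfolding connects_def
  proof (intro allI impI)
    fix A assume A: "A \<subseteq> ?V" "uncut (?E - {e}) A"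
    have "e \<subseteq> A \<or> e \<inter> A = {}"
      using C(1) that by (rule graph_cycle_uncut) (use A(2) CE in \<open>blast intro: uncut_mono\<close>)
    with A(2) have "uncut ?E A"
      unfolding uncut_def by blast
    with A(1) E_conn show "A = {} \<or> A = ?V"
      unfolding connects_def by blast
  qed
  have conn_iff: "{S. S \<subseteq> ?E \<and> connects S ?V} = insert ?E ((\<lambda>e. ?E - {e}) ` C)" (is "?L = ?R")
  proof
    show "?R \<subseteq> ?L"
      using E_conn conn by auto
    show "?L \<subseteq> ?R"
    proof
      fix S assume "S \<in> ?L"
      then have S: "S \<subseteq> ?E" "connects S ?V"
        by auto
      show "S \<in> ?R"
      proof (cases "S = ?E")
        case False
        with S(1) obtain e where e: "e \<in> ?E" "e \<notin> S"
          by blast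
        with S bridge1 have eC: "e \<in> C"
          using connects_bridge_mem by blast
        have "S \<subseteq> ?E - {e}"
          using S(1) e(2) by blast
        moreover have "f \<in> S" if "f \<in> ?E - {e}" for f
          using S(2) bridge2 [OF eC that] \<open>S \<subseteq> ?E - {e}\<close> by (rule connects_bridge_mem)
        ultimately have "S = ?E - {e}"
          by blast
        with eC show ?thesis
          by blast
      qed simp
    qed
  qed
  obtain e where e: "e \<in> C"
    using C(2) by blast
  then have "e \<in> ?E"
    using CE by blast
  have "?V \<noteq> {}"
    using assms(2) by (simp add: connected_conv)
  \<comment> \<open>\<open>?E - {e}\<close> is a spanning tree; adding \<open>e\<close> back gives
    as many edges as vertices.\<close>
  then have "card ?V = Suc (card (?E - {e}))"
    using pair_finite_verts E conn [OF e] bridge2 [OF e] by (intro card_tree) auto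
  then have card_E: "card ?E = card ?V" "card ?V > 0"
    using card.remove [OF E(1) \<open>e \<in> ?E\<close>] by simp_all
  have "inj_on (\<lambda>e. ?E - {e}) C"
    using CE by (intro inj_onI) blast
  then have "(\<Sum>S | S \<subseteq> ?E \<and> connects S ?V. (- 1) ^ card S) =
      (- 1) ^ card ?E + (\<Sum>e\<in>C. (- 1) ^ card (?E - {e}) :: 'b)"
    unfolding conn_iff using CE E(1) finite_subset [OF CE E(1)]
    by (subst sum.insert) (auto simp: sum.reindex)
  also have "(\<Sum>e\<in>C. (- 1) ^ card (?E - {e}) :: 'b) = (\<Sum>e\<in>C. (- 1) ^ (card ?V - 1))"
    using CE card_E by (intro sum.cong refl) auto
  also have "(- 1) ^ card ?E = - ((- 1) ^ (card ?V - 1) :: 'b)"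
    using card_E by (cases "card ?V") auto
  finally show ?thesis
    by (simp add: algebra_simps)
qed

section \<open>Connecting edge sets of the star\<close>

lemma edges_star_graph: "edges (star_graph n) = (\<lambda>j. {0, j}) ` {1..<n}"
  by (force simp: edges_def star_graph_def insert_commute)

lemma pverts_star_graph: "pverts (star_graph n) = {..<n}"
  by (simp add: star_graph_def)

text \<open>Omitting the edge \<open>{0, j}\<close> isolates the leaf \<open>j\<close>, so only the
  full set of \<open>n - 1\<close> edges connects.\<close>

lemma star_connected_sum:
  assumes "n > 0"
  shows "(\<Sum>S | S \<subseteq> edges (star_graph n) \<and> connects S (pverts (star_graph n)). (- 1) ^ card S) =
    ((- 1) ^ (n - 1) :: 'b :: comm_ring_1)"
proof -
  let ?E = "edges (star_graph n)"
  have "connects ?E {..<n}"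
    unfolding connects_def
  proof (intro allI impI)
    fix A assume A: "A \<subseteq> {..<n}" "uncut ?E A"
    have "j \<in> A \<longleftrightarrow> 0 \<in> A" if "j < n" for j
      using A(2) that by (cases "j = 0") (auto simp: uncut_def edges_star_graph)
    with A(1) show "A = {} \<or> A = {..<n}"
      by blast
  qed
  moreover have "S = ?E" if S: "S \<subseteq> ?E" "connects S {..<n}" for S
  proof (rule ccontr)
    assume "S \<noteq> ?E"
    then obtain e where "e \<in> ?E" "e \<notin> S"
      using S(1) by blast
    then obtain j where j: "1 \<le> j" "j < n" "{0, j} \<notin> S"
      by (auto simp: edges_star_graph)
    have "uncut S {j}"
      unfolding uncut_def
    proof
      fix e assume "e \<in> S"
      then obtain k where "e = {0, k}"
        using S(1) by (auto simp: edges_star_graph)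
      with \<open>e \<in> S\<close> j have "j \<notin> e"
        by auto
      then show "e \<subseteq> {j} \<or> e \<inter> {j} = {}"
        by blast
    qed
    moreover have "{j} \<subseteq> {..<n}"
      using j(2) by simp
    moreover have "0 \<in> {..<n}" "0 \<notin> {j}"
      using j by simp_all
    ultimately show False
      using S(2) unfolding connects_def by (metis insert_not_empty)
  qed
  ultimately have "{S. S \<subseteq> ?E \<and> connects S (pverts (star_graph n))} = {?E}"
    unfolding pverts_star_graph by blast
  moreover have "card ?E = n - 1"
    unfolding edges_star_graph by (subst card_image) (auto simp: inj_on_def doubleton_eq_iff)
  ultimately show ?thesis
    by simp
qed

section \<open>The star coefficient\<close>

text \<open>The powers of \<open>cis (2 * pi / n)\<close> with exponents below \<open>n\<close> are
  pairwise distinct, and exponent 0 already gives 1.\<close>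

lemma primitive_root_unity_exists:
  assumes "n > 0"
  obtains z :: complex where "z ^ n = 1" "\<And>k. 0 < k \<Longrightarrow> k < n \<Longrightarrow> z ^ k \<noteq> 1"
proof
  let ?z = "cis (2 * pi / n)"
  have pow: "?z ^ k = cis (2 * pi * real k / real n)" for k
    by (simp add: DeMoivre mult_ac)
  show "?z ^ n = 1"
    unfolding pow using assms by simp
  have inj: "inj_on (\<lambda>k. cis (2 * pi * real k / real n)) {..<n}"
    using bij_betw_roots_unity [OF assms] by (rule bij_betw_imp_inj_on)
  show "?z ^ k \<noteq> 1" if "0 < k" "k < n" for k
    using inj_onD [OF inj, of k 0] that by (auto simp: pow)
qed

text \<open>Such a partition has at least two parts, all positive, so each is smaller than
  \<open>n\<close>.\<close>

lemma partition_part_less: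
  assumes "\<mu> \<in> partitions n" "\<mu> \<noteq> {#n#}" "n > 0"
  obtains k where "k \<in># \<mu>" "0 < k" "k < n"
proof -
  obtain k \<nu> where \<mu>: "\<mu> = add_mset k \<nu>"
    using assms by (cases \<mu>) (auto simp: partitions_def)
  have "0 \<notin># \<nu>" "k > 0" "k + sum_mset \<nu> = n"
    using assms(1) by (auto simp: \<mu> partitions_def)
  moreover have "\<nu> \<noteq> {#}"
    using assms(1,2) by (auto simp: \<mu> partitions_def)
  then obtain l \<nu>' where "\<nu> = add_mset l \<nu>'"
    by (cases \<nu>) auto
  ultimately have "k < n"
    by auto
  with \<open>k > 0\<close> show ?thesis
    by (intro that [of k]) (auto simp: \<mu>)
qed

theorem corollary3p4:
  fixes G :: "'a pair_pre_digraph"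
    and C :: "'a set set"
    and n c :: nat
    and coeff :: "nat multiset \<Rightarrow> rat"
  assumes "pair_graph G"
    and "Digraph_Component.connected (with_proj G)"
    and "card (pverts G) = n"
    and "unicyclic G"
    and "C \<in> graph_cycles G"
    and "card C = c"
    and "c \<ge> 3"
    and "chromatic_symfun G = (\<Sum>\<mu>\<in>partitions n. mps_scale (coeff \<mu>) (star_symfun \<mu>))"
  shows "coeff {#n#} = of_nat c - 1"
proof -
  interpret pair_graph G by fact
  have V: "pverts G \<noteq> {}"
    using assms(2) by (simp add: connected_conv)
  with assms(3) have n: "n > 0"
    using pair_finite_verts by (metis card_gt_0_iff)
  obtain z :: complex where z: "z ^ n = 1" "\<And>k. 0 < k \<Longrightarrow> k < n \<Longrightarrow> z ^ k \<noteq> 1"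
    using primitive_root_unity_exists [OF n] by blast
  let ?\<phi> = "specialize {..<n} (\<lambda>i. z ^ i)"
  have star: "?\<phi> (chromatic_symfun (star_graph k)) =
      (if k = n then fps_const (of_nat n * (- 1) ^ (n - 1)) * fps_X ^ n else 0)"
    if "0 < k" "k \<le> n" for k
    using specialize_chromatic_root_unity [OF pair_graph_star_graph [of k] z]
      star_connected_sum [OF n, where 'b = complex] that
    by (auto simp: pverts_star_graph lessThan_empty_iff)
  have stars: "?\<phi> (star_symfun \<mu>) = 0" if \<mu>: "\<mu> \<in> partitions n - {{#n#}}" for \<mu>
  proof -
    obtain k where "k \<in># \<mu>" "0 < k" "k < n"
      using partition_part_less \<mu> n by blast
    with star [of k] show ?thesis
      by (auto simp: star_symfun_def specialize_prod_mset prod_mset_zero_iff)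
  qed
  have "{#n#} \<in> partitions n"
    using n by (simp add: partitions_def)
  \<comment> \<open>Every partition other than \<open>{#n#}\<close> has a part in the range where
    \<open>star\<close> gives 0, so a single summand survives.\<close>
  then have "?\<phi> (chromatic_symfun G) = fps_const (of_rat (coeff {#n#})) * ?\<phi> (star_symfun {#n#})"
    unfolding assms(8) specialize_sum specialize_scale
    by (subst sum.remove [OF finite_partitions]) (auto simp: stars intro!: sum.neutral)
  also have "?\<phi> (star_symfun {#n#}) = fps_const (of_nat n * (- 1) ^ (n - 1)) * fps_X ^ n"
    using star [of n] n by (simp add: star_symfun_def)
  finally have "fps_nth (?\<phi> (chromatic_symfun G)) n =
      of_rat (coeff {#n#}) * (of_nat n * (- 1) ^ (n - 1))"
    by simp
  moreover have "C \<noteq> {}"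
    using assms(6,7) by auto
  then have "fps_nth (?\<phi> (chromatic_symfun G)) n =
      of_nat n * ((- 1) ^ (n - 1) * (of_nat c - 1))"
    using specialize_chromatic_root_unity [OF assms(1) z V]
      unicyclic_connected_sum [OF assms(1,2,4,5), where 'b = complex]
    by (simp add: assms(3,6))
  \<comment> \<open>The common factor \<open>of_nat n * (- 1) ^ (n - 1)\<close> is nonzero because
    \<open>n > 0\<close>, and cancels.\<close>
  ultimately have "(of_rat (coeff {#n#}) :: complex) = of_rat (of_nat c - 1)"
    using n by (simp add: of_rat_diff)
  then show ?thesis
    by (simp only: of_rat_eq_iff)
qed

end
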